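(* Let $d\ge1$ and let $(\mathbb Z^d,E,\mu,w)$ be the weighted nearest-neighbour lattice graph with vertex measure $\mu(x)=\sum_{y\sim x}w_{xy}$, satisfying $0<\mu_{\min}\le\mu_{\max}<\infty$ and $\inf_{x\sim y}w_{xy}>0$, with normalized Laplacian $\Delta$. Then for every $u\in\ell^\infty(\mathbb Z^d)$, $$\lim_{s\to1^-}\bigl\|(-\Delta)^su+\Delta u\bigr\|_{\ell^\infty(\mathbb Z^d)}=0 .$$
   Context: Weighted lattice graph: vertex set $\mathbb Z^d$, with $x\sim y$ iff $|x-y|_1=1$; symmetric weights $w_{xy}=w_{yx}>0$ if $x\sim y$ and $w_{xy}=0$ otherwise (in particular $w_{xx}=0$); $\mu(x)=\sum_{y\sim x}w_{xy}$; $\mu_{\min}=\inf_x\mu(x)$, $\mu_{\max}=\sup_x\mu(x)$. The normalized Laplacian is $\Delta u(x)=\frac1{\mu(x)}\sum_{y\sim x}w_{xy}(u(y)-u(x))$, a bounded self-adjoint operator on $\ell^2(\mathbb Z^d,\mu)$. The heat kernel $p(t,x,y)$, $t\ge0$, is defined by $e^{t\Delta}u(x)=\sum_{y}p(t,x,y)u(y)\mu(y)$, i.e. $p(t,x,y)=\mu(y)^{-1}(e^{t\Delta}\mathbf 1_{\{y\}})(x)$. For $0<s<1$ and $u\in\ell^\infty(\mathbb Z^d)$ the fractional Laplacian is $$(-\Delta)^su(x)=\frac1{\mu(x)}\sum_{y\ne x}W_s(x,y)\bigl(u(x)-u(y)\bigr),\qquad W_s(x,y)=\frac{s}{\Gamma(1-s)}\mu(x)\mu(y)\int_0^\infty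 p(t,x,y)\,t^{-1-s}\,dt .$$ *)

theory Defs
  imports "HOL-Analysis.Analysis"
begin

text \<open>
  The lattice of dimension \<open>d \<ge> 1\<close> is the type \<open>int ^ 'd\<close> with \<open>d = CARD('d)\<close>.  The graph is given by
  its weight function \<open>w\<close>.
\<close>

definition lattice_adj :: "int ^ 'd \<Rightarrow> int ^ 'd \<Rightarrow> bool" where
  "lattice_adj x y \<longleftrightarrow> (\<Sum>i\<in>UNIV. \<bar>x $ i - y $ i\<bar>) = 1"

definition lattice_weights :: "(int ^ 'd \<Rightarrow> int ^ 'd \<Rightarrow> real) \<Rightarrow> bool" where
  "lattice_weights w \<longleftrightarrow>
     (\<forall>x y. w x y = w y x) \<and>
     (\<forall>x y. lattice_adj x y \<longrightarrow> 0 < w x y) \<and>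
     (\<forall>x y. \<not> lattice_adj x y \<longrightarrow> w x y = 0)"

text \<open>The sums over neighbours below are finite sums.\<close>

lemma finite_lattice_adj: "finite {y. lattice_adj x y}"
proof (rule finite_subset)
  show "{y. lattice_adj x y} \<subseteq> (\<lambda>f. \<chi> i. x $ i - f i) ` (UNIV \<rightarrow>\<^sub>E {-1..1})"
  proof
    fix y assume y: "y \<in> {y. lattice_adj x y}"
    have le: "\<bar>x $ i - y $ i\<bar> \<le> 1" for i
    proof -
      have "\<bar>x $ i - y $ i\<bar> \<le> (\<Sum>j\<in>UNIV. \<bar>x $ j - y $ j\<bar>)"
        by (rule member_le_sum[where f = "\<lambda>j. \<bar>x $ j - y $ j\<bar>"]) simp_all
      also have "\<dots> = 1"
        using y by (simp only: lattice_adj_def mem_Collect_eq)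
      finally show ?thesis .
    qed
    have "x $ i - y $ i \<in> {-1..1}" for i
      using le[of i] by (simp only: abs_le_iff atLeastAtMost_iff minus_le_iff)
    then have "(\<lambda>i. x $ i - y $ i) \<in> UNIV \<rightarrow>\<^sub>E {-1..1}"
      by (intro PiE_I) simp_all
    then have "(\<lambda>f. \<chi> i. x $ i - f i) (\<lambda>i. x $ i - y $ i)
        \<in> (\<lambda>f. \<chi> i. x $ i - f i) ` (UNIV \<rightarrow>\<^sub>E {-1..1})"
      by (rule imageI)
    moreover have "(\<lambda>f. \<chi> i. x $ i - f i) (\<lambda>i. x $ i - y $ i) = y"
      by (simp add: vec_eq_iff)
    ultimately show "y \<in> (\<lambda>f. \<chi> i. x $ i - f i) ` (UNIV \<rightarrow>\<^sub>E {-1..1})"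
      by (simp only:)
  qed
  show "finite ((\<lambda>f. \<chi> i. x $ i - f i) ` (UNIV \<rightarrow>\<^sub>E {-1..1}))"
    by (intro finite_imageI finite_PiE finite finite_atLeastAtMost_int)
qed

definition vertex_measure :: "(int ^ 'd \<Rightarrow> int ^ 'd \<Rightarrow> real) \<Rightarrow> int ^ 'd \<Rightarrow> real" where
  "vertex_measure w x = (\<Sum>y | lattice_adj x y. w x y)"

text \<open>Infima, suprema and sup norms are taken in \<^typ>\<open>ereal\<close>, so that they are meaningful without
  any boundedness assumption.\<close>

definition mu_min :: "(int ^ 'd \<Rightarrow> int ^ 'd \<Rightarrow> real) \<Rightarrow> ereal" where
  "mu_min w = (INF x. ereal (vertex_measure w x))"

definition mu_max :: "(int ^ 'd \<Rightarrow> int ^ 'd \<Rightarrow> real) \<Rightarrow> ereal" where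
  "mu_max w = (SUP x. ereal (vertex_measure w x))"

definition edge_weight_inf :: "(int ^ 'd \<Rightarrow> int ^ 'd \<Rightarrow> real) \<Rightarrow> ereal" where
  "edge_weight_inf w = (INF (x, y)\<in>{(x, y). lattice_adj x y}. ereal (w x y))"

definition linf_norm :: "('a \<Rightarrow> real) \<Rightarrow> ereal" where
  "linf_norm f = (SUP x. ereal \<bar>f x\<bar>)"

definition laplacian ::
    "(int ^ 'd \<Rightarrow> int ^ 'd \<Rightarrow> real) \<Rightarrow> (int ^ 'd \<Rightarrow> real) \<Rightarrow> int ^ 'd \<Rightarrow> real" where
  "laplacian w u x = 1 / vertex_measure w x * (\<Sum>y | lattice_adj x y. w x y * (u y - u x))"

definition l2_space :: "('a \<Rightarrow> real) \<Rightarrow> ('a \<Rightarrow> real) set" where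
  "l2_space m = {u. (\<lambda>x. (u x)\<^sup>2 * m x) summable_on UNIV}"

definition l2_norm :: "('a \<Rightarrow> real) \<Rightarrow> ('a \<Rightarrow> real) \<Rightarrow> real" where
  "l2_norm m u = sqrt (\<Sum>\<^sub>\<infinity>x. (u x)\<^sup>2 * m x)"

text \<open>
  For \<open>u\<close> in the weighted \<open>\<ell>\<^sup>2\<close> space, \<open>heat_semigroup w t u\<close> is \<open>exp (t \<Delta>) u\<close>: the sum of the exponential
  series of the bounded operator \<open>t \<Delta>\<close>, with convergence in the weighted \<open>\<ell>\<^sup>2\<close> norm.
\<close>

definition heat_semigroup ::
    "(int ^ 'd \<Rightarrow> int ^ 'd \<Rightarrow> real) \<Rightarrow> real \<Rightarrow> (int ^ 'd \<Rightarrow> real) \<Rightarrow> int ^ 'd \<Rightarrow> real" where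
  "heat_semigroup w t u =
     (THE v. v \<in> l2_space (vertex_measure w) \<and>
        (\<lambda>N. l2_norm (vertex_measure w)
               (\<lambda>x. (\<Sum>n<N. t ^ n / fact n * (laplacian w ^^ n) u x) - v x)) \<longlonglongrightarrow> 0)"

definition heat_kernel ::
    "(int ^ 'd \<Rightarrow> int ^ 'd \<Rightarrow> real) \<Rightarrow> real \<Rightarrow> int ^ 'd \<Rightarrow> int ^ 'd \<Rightarrow> real" where
  "heat_kernel w t x y = 1 / vertex_measure w y * heat_semigroup w t (indicator {y}) x"

text \<open>Only the values at \<open>x \<noteq> y\<close> matter; on the diagonal the integral diverges.\<close>

definition frac_weight ::
    "(int ^ 'd \<Rightarrow> int ^ 'd \<Rightarrow> real) \<Rightarrow> real \<Rightarrow> int ^ 'd \<Rightarrow> int ^ 'd \<Rightarrow> real" where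
  "frac_weight w s x y =
     s / Gamma (1 - s) * vertex_measure w x * vertex_measure w y *
       (LBINT t:{0<..}. heat_kernel w t x y * t powr (-1 - s))"

definition frac_laplacian ::
    "(int ^ 'd \<Rightarrow> int ^ 'd \<Rightarrow> real) \<Rightarrow> real \<Rightarrow> (int ^ 'd \<Rightarrow> real) \<Rightarrow> int ^ 'd \<Rightarrow> real" where
  "frac_laplacian w s u x =
     1 / vertex_measure w x * (\<Sum>\<^sub>\<infinity>y\<in>{y. y \<noteq> x}. frac_weight w s x y * (u x - u y))"

end

theory Submission
  imports Defs
begin

text \<open>
  Let \<open>P\<close> be the transition operator of the nearest-neighbour random walk that jumps from \<open>x\<close> to \<open>y\<close> with
  probability \<open>w x y / \<mu>(x)\<close>, so that \<open>\<Delta> = P - I\<close>, and let \<open>p\<^sub>n(x,y)\<close> be its \<open>n\<close>-step probabilities. The heat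
  semigroup is the walk in Poisson time,
  \<open>\<mu>(y) p(t,x,y) = exp (- t) (\<Sum>n. t\<^sup>n / n! p\<^sub>n(x,y))\<close> (\<open>heat_semigroup_indicator_poisson\<close>). Integrating
  against \<open>t powr (- 1 - s)\<close> term by term turns the powers of \<open>t\<close> into Gamma values, and for \<open>x \<noteq> y\<close>
  \<open>W\<^sub>s(x,y) = \<mu>(x) (\<Sum>n\<ge>1. c\<^sub>n(s) p\<^sub>n(x,y))\<close> with \<open>c\<^sub>n(s) = s Gamma (n - s) / (Gamma (1 - s) n!)\<close>
  (\<open>frac_weight_sums\<close>).

  The coefficients \<open>c\<^sub>n(s)\<close> are those of \<open>1 - (1 - z) powr s\<close>: they are nonnegative with sum \<open>1\<close>, and
  \<open>c\<^sub>1(s) = s\<close>. Hence the coefficients with \<open>n \<ge> 2\<close> have total mass at most \<open>1 - s\<close>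
  (\<open>sum_frac_coeff_tail_le\<close>). The term \<open>n = 1\<close> of the fractional Laplacian is \<open>- s \<Delta> u\<close>, and the other
  terms average increments of \<open>u\<close> with total weight at most \<open>1 - s\<close>. With \<open>\<bar>u\<bar> \<le> M\<close> this gives the rate
  \<open>\<bar>(-\<Delta>)\<^sup>s u(x) + \<Delta> u(x)\<bar> \<le> 4 M (1 - s)\<close> uniformly in \<open>x\<close> (\<open>frac_laplacian_plus_laplacian_le\<close>).

  The analytic work lies in identifying the heat semigroup, which is an exponential series converging
  in the weighted \<open>\<ell>\<^sup>2\<close> space. On a point mass, \<open>\<Delta>\<^sup>n\<close> is dominated by \<open>(P + I)\<^sup>n\<close>, which is bounded by \<open>2\<^sup>n\<close> in the
  sup norm since \<open>P\<close> is an averaging operator, and by \<open>2\<^sup>n \<mu>(y)\<close> in the weighted \<open>\<ell>\<^sup>1\<close> norm since the walk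
  is reversible. Interpolating between the two bounds the \<open>\<ell>\<^sup>2\<close> norm of the tails.
\<close>

section \<open>The random walk of a weighted lattice\<close>

locale weighted_lattice =
  fixes w :: "int ^ 'd \<Rightarrow> int ^ 'd \<Rightarrow> real"
  assumes weights: "lattice_weights w"
    and measure_pos: "0 < vertex_measure w x"
begin

abbreviation m where "m \<equiv> vertex_measure w"

definition walk :: "(int ^ 'd \<Rightarrow> real) \<Rightarrow> int ^ 'd \<Rightarrow> real" where
  "walk f x = (\<Sum>y | lattice_adj x y. w x y * f y) / m x"

definition step_prob :: "nat \<Rightarrow> int ^ 'd \<Rightarrow> int ^ 'd \<Rightarrow> real" where
  "step_prob n x y = (walk ^^ n) (indicator {y}) x"

lemma weight_sym: "w x y = w y x"
  using weights by (simp add: lattice_weights_def)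

lemma weight_nonneg: "0 \<le> w x y"
  using weights unfolding lattice_weights_def by (metis less_eq_real_def)

lemma weight_eq_0: "\<not> lattice_adj x y \<Longrightarrow> w x y = 0"
  using weights by (simp add: lattice_weights_def)

lemma sum_weight_le:
  assumes "finite F"
  shows "(\<Sum>y\<in>F. w x y) \<le> m x"
proof -
  have "(\<Sum>y\<in>F. w x y) = (\<Sum>y\<in>F \<inter> {y. lattice_adj x y}. w x y)"
    using assms weight_eq_0 by (intro sum.mono_neutral_right) auto
  also have "\<dots> \<le> m x"
    unfolding vertex_measure_def
    by (rule sum_mono2) (auto simp: finite_lattice_adj weight_nonneg)
  finally show ?thesis .
qed

lemma walk_sum:
  "walk (\<lambda>x. \<Sum>i\<in>I. c i * g i x) x = (\<Sum>i\<in>I. c i * walk (g i) x)"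
  unfolding walk_def sum_distrib_left sum_divide_distrib
  by (subst sum.swap) (simp add: mult_ac)

lemma walk_mono:
  assumes "\<And>y. f y \<le> g y"
  shows "walk f x \<le> walk g x"
  unfolding walk_def using measure_pos[of x]
  by (intro divide_right_mono sum_mono mult_left_mono assms weight_nonneg) auto

lemma walk_const: "walk (\<lambda>_. c) x = c"
  unfolding walk_def using measure_pos[of x]
  by (simp add: vertex_measure_def flip: sum_distrib_right)

text \<open>
  The walk is reversible with respect to \<open>\<mu>\<close>: as \<open>\<mu>(x) P(x,y) = w x y\<close> is symmetric, the factor
  picked up by \<open>f y\<close> is the total weight of the edges from \<open>y\<close> into \<open>F\<close>, which is at most \<open>\<mu>(y)\<close>.
  Stating the mass bound over all finite sets makes it stable under iteration and avoids infinite sums.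
\<close>

lemma walk_mass_le:
  assumes nonneg: "\<And>x. 0 \<le> f x"
    and mass: "\<And>F. finite F \<Longrightarrow> (\<Sum>x\<in>F. m x * f x) \<le> C"
    and "finite F"
  shows "(\<Sum>x\<in>F. m x * walk f x) \<le> C"
proof -
  define N where "N = (\<Union>x\<in>F. {y. lattice_adj x y})"
  have N: "finite N"
    using \<open>finite F\<close> by (simp add: N_def finite_lattice_adj)
  have "m x * walk f x = (\<Sum>y\<in>N. w x y * f y)" if "x \<in> F" for x
  proof -
    have "m x * walk f x = (\<Sum>y | lattice_adj x y. w x y * f y)"
      using measure_pos[of x] by (simp add: walk_def)
    also have "\<dots> = (\<Sum>y\<in>N. w x y * f y)"
      using that N weight_eq_0 by (intro sum.mono_neutral_left) (auto simp: N_def)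
    finally show ?thesis .
  qed
  then have "(\<Sum>x\<in>F. m x * walk f x) = (\<Sum>x\<in>F. \<Sum>y\<in>N. w x y * f y)"
    by simp
  also have "\<dots> = (\<Sum>y\<in>N. (\<Sum>x\<in>F. w y x) * f y)"
    by (subst sum.swap) (simp add: sum_distrib_right weight_sym)
  also have "\<dots> \<le> (\<Sum>y\<in>N. m y * f y)"
    by (intro sum_mono mult_right_mono sum_weight_le nonneg \<open>finite F\<close>)
  also have "\<dots> \<le> C"
    by (rule mass[OF N])
  finally show ?thesis .
qed

lemma step_prob_0: "step_prob 0 x y = indicator {y} x"
  by (simp add: step_prob_def)

lemma step_prob_Suc: "step_prob (Suc n) x y = walk (\<lambda>z. step_prob n z y) x"
  by (simp add: step_prob_def)

lemma step_prob_nonneg: "0 \<le> step_prob n x y"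
proof (induction n arbitrary: x)
  case (Suc n)
  then show ?case
    using walk_mono[of "\<lambda>_. 0" "\<lambda>z. step_prob n z y" x] by (simp add: step_prob_Suc walk_const)
qed (simp add: step_prob_0)

lemma step_prob_1:
  "step_prob (Suc 0) x y = w x y / m x"
proof -
  have "(\<Sum>z | lattice_adj x z. w x z * indicator {y} z) = (\<Sum>z\<in>{y}. w x z)"
    using finite_lattice_adj weight_eq_0
    by (intro sum.mono_neutral_cong) (auto simp: indicator_def)
  then show ?thesis
    by (simp add: step_prob_Suc step_prob_0 walk_def)
qed

lemma sum_step_prob_le_1:
  assumes "finite F"
  shows "(\<Sum>y\<in>F. step_prob n x y) \<le> 1"
proof (induction n arbitrary: x)
  case 0
  have "(\<Sum>y\<in>F. step_prob 0 x y) = (\<Sum>y\<in>F. if x = y then 1 else 0)"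
    by (rule sum.cong) (auto simp: step_prob_0 indicator_def)
  then show ?case
    using assms by simp
next
  case (Suc n)
  have "(\<Sum>y\<in>F. step_prob (Suc n) x y) = walk (\<lambda>z. \<Sum>y\<in>F. step_prob n z y) x"
    using walk_sum[of "\<lambda>_. 1" "\<lambda>y z. step_prob n z y" F x] by (simp add: step_prob_Suc)
  also have "\<dots> \<le> 1"
    using walk_mono[OF Suc.IH, of "\<lambda>x. x" x] by (simp add: walk_const)
  finally show ?case .
qed

lemma step_prob_le_1: "step_prob n x y \<le> 1"
  using sum_step_prob_le_1[of "{y}" n x] by simp

text \<open>
  Together with \<open>step_prob_le_1\<close> this controls the columns of the transition matrices in the sup norm
  and in the weighted \<open>\<ell>\<^sup>1\<close> norm at once, which is how the weighted \<open>\<ell>\<^sup>2\<close> norm is reached below.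
\<close>

lemma sum_measure_step_prob_le:
  assumes "finite F"
  shows "(\<Sum>x\<in>F. m x * step_prob n x y) \<le> m y"
  using assms
proof (induction n arbitrary: F)
  case 0
  have "(\<Sum>x\<in>F. m x * step_prob 0 x y) = (\<Sum>x\<in>F. if x = y then m y else 0)"
    by (rule sum.cong) (auto simp: step_prob_0 indicator_def)
  then show ?case
    using 0 measure_pos[of y] by simp
next
  case (Suc n)
  show ?case
    unfolding step_prob_Suc by (rule walk_mass_le[OF step_prob_nonneg Suc.IH Suc.prems])
qed

lemma laplacian_walk: "laplacian w f x = walk f x - f x"
proof -
  have "(\<Sum>y | lattice_adj x y. w x y * (f y - f x))
      = (\<Sum>y | lattice_adj x y. w x y * f y) - m x * f x"
    by (simp add: vertex_measure_def right_diff_distrib sum_subtractf sum_distrib_right)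
  then show ?thesis
    using measure_pos[of x] by (simp add: laplacian_def walk_def diff_divide_distrib)
qed

end

section \<open>Powers of the Laplacian\<close>

text \<open>
  The \<open>n + 1\<close>st finite difference of a sequence is the \<open>n\<close>th finite difference of its differences.
  With the step probabilities as the sequence, this is the inductive step for expanding \<open>(P - I)\<^sup>n\<close>.
\<close>

lemma sum_binomial_alternating_Suc:
  fixes g :: "nat \<Rightarrow> real"
  shows "(\<Sum>k\<le>Suc n. real (Suc n choose k) * (-1) ^ (Suc n - k) * g k)
       = (\<Sum>k\<le>n. real (n choose k) * (-1) ^ (n - k) * (g (Suc k) - g k))"
proof -
  have "(\<Sum>k\<le>n. real (n choose k) * (-1) ^ (n - k) * g k)
      = - (\<Sum>k\<le>Suc n. real (n choose k) * (-1) ^ (Suc n - k) * g k)"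
    by (simp add: Suc_diff_le flip: sum_negf)
  also have "\<dots> = - ((-1) ^ Suc n * g 0
      + (\<Sum>k\<le>n. real (n choose Suc k) * (-1) ^ (n - k) * g (Suc k)))"
    by (subst sum.atMost_Suc_shift) simp
  finally have shift: "(\<Sum>k\<le>n. real (n choose k) * (-1) ^ (n - k) * g k) = \<dots>" .
  have "(\<Sum>k\<le>Suc n. real (Suc n choose k) * (-1) ^ (Suc n - k) * g k)
      = (-1) ^ Suc n * g 0 + (\<Sum>k\<le>n. real (n choose k) * (-1) ^ (n - k) * g (Suc k))
        + (\<Sum>k\<le>n. real (n choose Suc k) * (-1) ^ (n - k) * g (Suc k))"
    by (subst sum.atMost_Suc_shift) (simp add: algebra_simps sum.distrib)
  then show ?thesis
    using shift by (simp add: right_diff_distrib sum_subtractf)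
qed

context weighted_lattice
begin

lemma laplacian_power_binomial:
  "(laplacian w ^^ n) (indicator {y}) x
     = (\<Sum>k\<le>n. real (n choose k) * (-1) ^ (n - k) * step_prob k x y)"
proof (induction n arbitrary: x)
  case 0
  show ?case by (simp add: step_prob_0)
next
  case (Suc n)
  have "(laplacian w ^^ Suc n) (indicator {y}) x
      = laplacian w (\<lambda>x. \<Sum>k\<le>n. real (n choose k) * (-1) ^ (n - k) * step_prob k x y) x"
    by (simp add: Suc.IH[abs_def])
  also have "\<dots> = (\<Sum>k\<le>n. real (n choose k) * (-1) ^ (n - k) * (step_prob (Suc k) x y - step_prob k x y))"
    by (simp add: laplacian_walk walk_sum step_prob_Suc right_diff_distrib sum_subtractf)
  finally show ?case
    by (simp only: sum_binomial_alternating_Suc)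
qed

text \<open>
  Dropping the signs replaces \<open>(P - I)\<^sup>n\<close> by \<open>(P + I)\<^sup>n\<close>, whose mass is \<open>2\<^sup>n\<close> times the initial one.
\<close>

lemma abs_laplacian_power_le:
  "\<bar>(laplacian w ^^ n) (indicator {y}) x\<bar> \<le> (\<Sum>k\<le>n. real (n choose k) * step_prob k x y)"
  unfolding laplacian_power_binomial
  by (rule order_trans[OF sum_abs]) (simp add: abs_mult power_abs step_prob_nonneg)

lemma sum_binomial: "(\<Sum>k\<le>n. real (n choose k)) = 2 ^ n"
  by (metis choose_row_sum of_nat_numeral of_nat_power of_nat_sum)

lemma abs_laplacian_power_le_sup:
  "\<bar>(laplacian w ^^ n) (indicator {y}) x\<bar> \<le> 2 ^ n"
proof -
  have "(\<Sum>k\<le>n. real (n choose k) * step_prob k x y) \<le> (\<Sum>k\<le>n. real (n choose k) * 1)"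
    by (intro sum_mono mult_left_mono step_prob_le_1) simp
  then show ?thesis
    using abs_laplacian_power_le[of n y x] by (simp add: sum_binomial)
qed

lemma sum_abs_laplacian_power_le:
  assumes "finite F"
  shows "(\<Sum>x\<in>F. m x * \<bar>(laplacian w ^^ n) (indicator {y}) x\<bar>) \<le> 2 ^ n * m y"
proof -
  have "(\<Sum>x\<in>F. m x * \<bar>(laplacian w ^^ n) (indicator {y}) x\<bar>)
      \<le> (\<Sum>x\<in>F. m x * (\<Sum>k\<le>n. real (n choose k) * step_prob k x y))"
    using measure_pos by (intro sum_mono mult_left_mono abs_laplacian_power_le) (auto intro: less_imp_le)
  also have "\<dots> = (\<Sum>k\<le>n. real (n choose k) * (\<Sum>x\<in>F. m x * step_prob k x y))"
    unfolding sum_distrib_left by (subst sum.swap) (simp add: mult_ac)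
  also have "\<dots> \<le> (\<Sum>k\<le>n. real (n choose k) * m y)"
    by (intro sum_mono mult_left_mono sum_measure_step_prob_le assms) simp
  finally show ?thesis
    by (simp add: sum_binomial flip: sum_distrib_right)
qed

end

section \<open>The weighted square-summable functions\<close>

text \<open>
  Interpolation between the sup norm and the weighted \<open>\<ell>\<^sup>1\<close> norm. It replaces the boundedness
  of \<open>\<Delta>\<close> on \<open>\<ell>\<^sup>2\<close>, since for powers of \<open>\<Delta>\<close> applied to a point mass both end points are elementary.
\<close>

lemma l2_space_interpolate:
  assumes measure: "\<And>x. 0 \<le> \<mu> x"
    and sup: "\<And>x. \<bar>g x\<bar> \<le> A"
    and mass: "\<And>F. finite F \<Longrightarrow> (\<Sum>x\<in>F. \<mu> x * \<bar>g x\<bar>) \<le> B"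
  shows "g \<in> l2_space \<mu>" and "l2_norm \<mu> g \<le> sqrt (A * B)"
proof -
  have "0 \<le> A"
    using sup[of undefined] by linarith
  have bound: "(\<Sum>x\<in>F. (g x)\<^sup>2 * \<mu> x) \<le> A * B" if "finite F" for F
  proof -
    have "(g x)\<^sup>2 * \<mu> x \<le> A * (\<mu> x * \<bar>g x\<bar>)" for x
    proof -
      have "(g x)\<^sup>2 * \<mu> x = \<bar>g x\<bar> * (\<mu> x * \<bar>g x\<bar>)"
        by (simp add: power2_eq_square)
      also have "\<dots> \<le> A * (\<mu> x * \<bar>g x\<bar>)"
        by (intro mult_right_mono sup) (simp add: measure)
      finally show ?thesis .
    qed
    then have "(\<Sum>x\<in>F. (g x)\<^sup>2 * \<mu> x) \<le> A * (\<Sum>x\<in>F. \<mu> x * \<bar>g x\<bar>)"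
      by (simp add: sum_distrib_left sum_mono)
    also have "\<dots> \<le> A * B"
      by (intro mult_left_mono mass that \<open>0 \<le> A\<close>)
    finally show ?thesis .
  qed
  have summable: "(\<lambda>x. (g x)\<^sup>2 * \<mu> x) summable_on UNIV"
    by (rule nonneg_bdd_above_summable_on) (use bound measure in \<open>auto intro!: bdd_aboveI\<close>)
  then show "g \<in> l2_space \<mu>"
    by (simp add: l2_space_def)
  show "l2_norm \<mu> g \<le> sqrt (A * B)"
    unfolding l2_norm_def
    by (intro real_sqrt_le_mono infsum_le_finite_sums summable bound)
qed

lemma l2_norm_nonneg:
  assumes "\<And>x. 0 \<le> \<mu> x"
  shows "0 \<le> l2_norm \<mu> f"
  unfolding l2_norm_def using assms by (intro real_sqrt_ge_zero infsum_nonneg) simp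

lemma l2_space_diff:
  assumes measure: "\<And>x. 0 \<le> \<mu> x" and f: "f \<in> l2_space \<mu>" and g: "g \<in> l2_space \<mu>"
  shows "(\<lambda>x. f x - g x) \<in> l2_space \<mu>"
proof -
  have "(\<lambda>x. 2 * ((f x)\<^sup>2 * \<mu> x) + 2 * ((g x)\<^sup>2 * \<mu> x)) summable_on UNIV"
    using f g unfolding l2_space_def by (intro summable_on_add summable_on_cmult_right) auto
  then have "(\<lambda>x. (f x - g x)\<^sup>2 * \<mu> x) summable_on UNIV"
  proof (rule summable_on_comparison_test)
    fix x
    have "(f x - g x)\<^sup>2 \<le> 2 * (f x)\<^sup>2 + 2 * (g x)\<^sup>2"
      using zero_le_power2[of "f x + g x"] by (simp add: power2_eq_square algebra_simps)
    then have "(f x - g x)\<^sup>2 * \<mu> x \<le> (2 * (f x)\<^sup>2 + 2 * (g x)\<^sup>2) * \<mu> x"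
      by (rule mult_right_mono) (rule measure)
    then show "(f x - g x)\<^sup>2 * \<mu> x \<le> 2 * ((f x)\<^sup>2 * \<mu> x) + 2 * ((g x)\<^sup>2 * \<mu> x)"
      by (simp add: algebra_simps)
  qed (simp add: measure)
  then show ?thesis
    by (simp add: l2_space_def)
qed

lemma abs_le_l2_norm:
  assumes measure: "\<And>x. 0 < \<mu> x" and g: "g \<in> l2_space \<mu>"
  shows "\<bar>g x\<bar> \<le> l2_norm \<mu> g / sqrt (\<mu> x)"
proof -
  have "(\<Sum>x\<in>{x}. (g x)\<^sup>2 * \<mu> x) \<le> (\<Sum>\<^sub>\<infinity>x. (g x)\<^sup>2 * \<mu> x)"
    using g measure by (intro finite_sum_le_infsum) (auto simp: l2_space_def less_imp_le)
  then have "sqrt ((g x)\<^sup>2 * \<mu> x) \<le> l2_norm \<mu> g"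
    by (simp add: l2_norm_def)
  then show ?thesis
    using measure[of x] by (simp add: real_sqrt_mult field_simps)
qed

text \<open>
  Membership in \<open>\<ell>\<^sup>2\<close> has to be assumed for every \<open>N\<close>: the norm is an infinite sum that takes the
  value \<open>0\<close> when it diverges, so small values of it mean nothing outside the space.
\<close>

lemma l2_limit_pointwise:
  assumes measure: "\<And>x. 0 < \<mu> x"
    and l2: "\<And>N. (\<lambda>x. S N x - v x) \<in> l2_space \<mu>"
    and lim: "(\<lambda>N. l2_norm \<mu> (\<lambda>x. S N x - v x)) \<longlonglongrightarrow> 0"
  shows "(\<lambda>N. S N x) \<longlonglongrightarrow> v x"
proof -
  have "(\<lambda>N. l2_norm \<mu> (\<lambda>x. S N x - v x) / sqrt (\<mu> x)) \<longlonglongrightarrow> 0"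
    using tendsto_divide[OF lim tendsto_const[of "sqrt (\<mu> x)"]] measure[of x] by simp
  then have "(\<lambda>N. S N x - v x) \<longlonglongrightarrow> 0"
    by (rule Lim_null_comparison[rotated])
      (use abs_le_l2_norm[OF measure l2] in \<open>auto intro!: eventuallyI\<close>)
  then show ?thesis
    by (simp add: LIM_zero_iff)
qed

section \<open>The heat semigroup on point masses\<close>

context weighted_lattice
begin

lemma heat_semigroup_eqI:
  assumes v: "v \<in> l2_space m"
    and l2: "\<And>N. (\<lambda>x. (\<Sum>n<N. t ^ n / fact n * (laplacian w ^^ n) u x) - v x) \<in> l2_space m"
    and lim: "(\<lambda>N. l2_norm m (\<lambda>x. (\<Sum>n<N. t ^ n / fact n * (laplacian w ^^ n) u x) - v x)) \<longlonglongrightarrow> 0"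
  shows "heat_semigroup w t u = v"
  unfolding heat_semigroup_def
proof (rule the_equality)
  fix v' assume v': "v' \<in> l2_space m \<and>
    (\<lambda>N. l2_norm m (\<lambda>x. (\<Sum>n<N. t ^ n / fact n * (laplacian w ^^ n) u x) - v' x)) \<longlonglongrightarrow> 0"
  have l2': "(\<lambda>x. (\<Sum>n<N. t ^ n / fact n * (laplacian w ^^ n) u x) - v' x) \<in> l2_space m" for N
    using l2_space_diff[OF _ l2[of N] l2_space_diff[OF _ conjunct1[OF v'] v]] measure_pos
    by (simp add: less_imp_le)
  show "v' = v"
  proof
    fix x
    show "v' x = v x"
      using LIMSEQ_unique[OF l2_limit_pointwise[OF measure_pos l2' conjunct2[OF v'], of x]
          l2_limit_pointwise[OF measure_pos l2 lim, of x]] .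
  qed
qed (use v lim in auto)

text \<open>
  The series converges absolutely at every point, so its pointwise sum is the only candidate
  for the \<open>\<ell>\<^sup>2\<close> limit. The tail after \<open>N\<close> terms is bounded by the tail \<open>e\<^sub>N\<close> of the series of \<open>exp (2 t)\<close> in the sup
  norm and by \<open>e\<^sub>N \<mu>(y)\<close> in the weighted \<open>\<ell>\<^sup>1\<close> norm, hence tends to \<open>0\<close> in \<open>\<ell>\<^sup>2\<close>.
\<close>

lemma heat_semigroup_indicator_sums:
  assumes "0 \<le> t"
  shows "(\<lambda>n. t ^ n / fact n * (laplacian w ^^ n) (indicator {y}) x)
    sums heat_semigroup w t (indicator {y}) x"
proof -
  define c where "c n x = t ^ n / fact n * (laplacian w ^^ n) (indicator {y}) x" for n x
  define q where "q n = (2 * t) ^ n / fact n" for n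
  define v where "v x = (\<Sum>n. c n x)" for x
  have q: "summable q"
    using summable_exp[of "2 * t"] by (simp add: q_def[abs_def] divide_inverse mult.commute)
  have q_tail: "summable (\<lambda>n. q (n + N))" for N
    using q by (simp add: summable_iff_shift)
  have abs_c: "\<bar>c n x\<bar> \<le> q n" for n x
    using mult_left_mono[OF abs_laplacian_power_le_sup[of n y x], of "t ^ n / fact n"] assms
    by (simp add: c_def q_def abs_mult power_mult_distrib mult.commute)
  have mass_c: "(\<Sum>x\<in>F. m x * \<bar>c n x\<bar>) \<le> q n * m y" if "finite F" for F n
    using mult_left_mono[OF sum_abs_laplacian_power_le[OF that, of n y], of "t ^ n / fact n"] assms
    by (simp add: c_def q_def abs_mult power_mult_distrib mult_ac sum_distrib_left)
  have abs_summable: "summable (\<lambda>n. \<bar>c (n + N) x\<bar>)" for x N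
    by (rule summable_comparison_test'[OF q_tail[of N]]) (simp add: abs_c)
  have summable_c: "summable (\<lambda>n. c n x)" for x
    using summable_rabs_cancel[OF abs_summable[of 0 x]] by simp
  define r where "r N x = v x - (\<Sum>n<N. c n x)" for N x
  have abs_r: "\<bar>r N x\<bar> \<le> (\<Sum>n. \<bar>c (n + N) x\<bar>)" for N x
    unfolding r_def v_def suminf_minus_initial_segment[OF summable_c, symmetric]
    by (rule summable_rabs[OF abs_summable])
  define e where "e N = (\<Sum>n. q (n + N))" for N
  have sup_r: "\<bar>r N x\<bar> \<le> e N" for N x
    unfolding e_def
    by (rule order_trans[OF abs_r suminf_le[OF abs_c abs_summable q_tail]])
  have mass_r: "(\<Sum>x\<in>F. m x * \<bar>r N x\<bar>) \<le> e N * m y" if "finite F" for F N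
  proof -
    have "(\<Sum>x\<in>F. m x * \<bar>r N x\<bar>) \<le> (\<Sum>x\<in>F. m x * (\<Sum>n. \<bar>c (n + N) x\<bar>))"
      using measure_pos by (intro sum_mono mult_left_mono abs_r) (auto intro: less_imp_le)
    also have "\<dots> = (\<Sum>n. \<Sum>x\<in>F. m x * \<bar>c (n + N) x\<bar>)"
      using abs_summable by (subst suminf_sum) (auto intro: summable_mult simp: suminf_mult)
    also have "\<dots> \<le> (\<Sum>n. q (n + N) * m y)"
      using abs_summable q_tail mass_c[OF that]
      by (intro suminf_le summable_sum summable_mult summable_mult2) auto
    also have "\<dots> = e N * m y"
      unfolding e_def by (rule suminf_mult2[OF q_tail, symmetric])
    finally show ?thesis .
  qed
  have m_nonneg: "0 \<le> m x" for x
    using measure_pos[of x] by simp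
  note r = l2_space_interpolate[of m, OF m_nonneg sup_r mass_r]
  have "e \<longlonglongrightarrow> 0"
  proof -
    have "(\<lambda>N. (\<Sum>n. q n) - (\<Sum>n<N. q n)) \<longlonglongrightarrow> 0"
      using tendsto_diff[OF tendsto_const[of "\<Sum>n. q n"] summable_LIMSEQ[OF q]] by simp
    then show ?thesis
      by (simp add: e_def[abs_def] suminf_minus_initial_segment[OF q])
  qed
  then have e: "(\<lambda>N. sqrt (e N * (e N * m y))) \<longlonglongrightarrow> 0"
    by (auto intro!: tendsto_eq_intros)
  have l2_uminus: "l2_norm m (\<lambda>x. - f x) = l2_norm m f" for f
    by (simp add: l2_norm_def)
  have "heat_semigroup w t (indicator {y}) = v"
  proof (rule heat_semigroup_eqI)
    show "v \<in> l2_space m"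
      using r(1)[of 0] by (simp add: r_def)
    show "(\<lambda>x. (\<Sum>n<N. t ^ n / fact n * (laplacian w ^^ n) (indicator {y}) x) - v x) \<in> l2_space m" for N
      using r(1)[of N] by (simp add: l2_space_def r_def c_def power2_commute[of "v x" for x])
    have eq: "(\<lambda>x. (\<Sum>n<N. t ^ n / fact n * (laplacian w ^^ n) (indicator {y}) x) - v x) = (\<lambda>x. - r N x)" for N
      by (simp add: r_def c_def)
    show "(\<lambda>N. l2_norm m (\<lambda>x. (\<Sum>n<N. t ^ n / fact n * (laplacian w ^^ n) (indicator {y}) x) - v x)) \<longlonglongrightarrow> 0"
      unfolding eq l2_uminus
      by (rule tendsto_sandwich[OF _ _ tendsto_const e])
        (use r(2) in \<open>auto intro!: eventuallyI l2_norm_nonneg m_nonneg\<close>)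
  qed
  then show ?thesis
    using summable_sums[OF summable_c[of x]] by (simp add: v_def c_def)
qed

text \<open>
  This is \<open>exp (t (P - I)) = exp (- t) exp (t P)\<close>: the walk run at the times of a Poisson process.
  Read as a Cauchy product of the series for \<open>exp (- t)\<close> and \<open>exp (t P)\<close>, it is the binomial expansion
  of the powers of \<open>P - I\<close>.
\<close>

lemma heat_semigroup_indicator_poisson:
  assumes "0 \<le> t"
  shows "(\<lambda>n. exp (- t) * (t ^ n / fact n * step_prob n x y)) sums heat_semigroup w t (indicator {y}) x"
proof -
  have exp_summable: "summable (\<lambda>n. t ^ n / fact n)"
    using summable_exp[of t] by (simp add: divide_inverse mult.commute)
  have walk_summable: "summable (\<lambda>n. norm (t ^ n / fact n * step_prob n x y))"
    by (rule summable_comparison_test'[OF exp_summable])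
      (use assms step_prob_nonneg step_prob_le_1 in \<open>auto simp: abs_mult intro!: mult_left_le divide_right_mono\<close>)
  have exp_minus: "(\<lambda>n. (- t) ^ n / fact n) sums exp (- t)"
    using exp_converges[of "- t"] by (simp add: divide_inverse mult.commute)
  have exp_minus_summable: "summable (\<lambda>n. norm ((- t) ^ n / fact n))"
    using exp_summable assms by (simp add: power_abs)
  have "(\<lambda>n. \<Sum>k\<le>n. t ^ k / fact k * step_prob k x y * ((- t) ^ (n - k) / fact (n - k)))
      sums ((\<Sum>n. t ^ n / fact n * step_prob n x y) * exp (- t))"
    using Cauchy_product_sums[OF walk_summable exp_minus_summable] sums_unique[OF exp_minus] by simp
  also have "(\<lambda>n. \<Sum>k\<le>n. t ^ k / fact k * step_prob k x y * ((- t) ^ (n - k) / fact (n - k)))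
      = (\<lambda>n. t ^ n / fact n * (laplacian w ^^ n) (indicator {y}) x)"
  proof
    fix n
    have "t ^ k / fact k * step_prob k x y * ((- t) ^ (n - k) / fact (n - k))
        = t ^ n / fact n * (real (n choose k) * (-1) ^ (n - k) * step_prob k x y)" if "k \<le> n" for k
    proof -
      have "t ^ n = t ^ k * t ^ (n - k)"
        using that by (simp flip: power_add)
      then show ?thesis
        by (simp add: binomial_fact[OF that] power_minus[of t] field_simps)
    qed
    then show "(\<Sum>k\<le>n. t ^ k / fact k * step_prob k x y * ((- t) ^ (n - k) / fact (n - k)))
        = t ^ n / fact n * (laplacian w ^^ n) (indicator {y}) x"
      by (simp add: laplacian_power_binomial sum_distrib_left)
  qed
  finally have "heat_semigroup w t (indicator {y}) x
      = exp (- t) * (\<Sum>n. t ^ n / fact n * step_prob n x y)"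
    using sums_unique2[OF heat_semigroup_indicator_sums[OF assms]] by (simp add: mult.commute)
  then show ?thesis
    using summable_sums[OF summable_norm_cancel[OF walk_summable], THEN sums_mult, of "exp (- t)"]
    by simp
qed

end

section \<open>The subordination coefficients\<close>

text \<open>
  For \<open>n \<ge> 1\<close> this is \<open>(- 1)\<^bsup>n - 1\<^esup> (s choose n)\<close>, the coefficient of \<open>z\<^sup>n\<close> in \<open>1 - (1 - z) powr s\<close>. The Gamma
  form is the one that the time integral of the heat kernel produces.
\<close>

definition frac_coeff :: "real \<Rightarrow> nat \<Rightarrow> real" where
  "frac_coeff s n = s * Gamma (real n - s) / (Gamma (1 - s) * fact n)"

lemma frac_coeff_nonneg:
  assumes "0 < s" "s < 1"
  shows "0 \<le> frac_coeff s (Suc n)"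
  unfolding frac_coeff_def using assms
  by (intro divide_nonneg_nonneg mult_nonneg_nonneg less_imp_le[OF Gamma_real_pos]) auto

lemma frac_coeff_1:
  assumes "s < 1"
  shows "frac_coeff s (Suc 0) = s"
proof -
  have "Gamma (1 - s) \<noteq> 0"
    using assms by (intro less_imp_neq[symmetric] Gamma_real_pos) simp
  then show ?thesis
    by (simp add: frac_coeff_def)
qed

text \<open>
  The partial sums telescope, because \<open>Gamma (N + 2 - s) = (N + 1 - s) Gamma (N + 1 - s)\<close>. The subtracted
  quotient is what is left of the total mass \<open>1\<close> after \<open>N\<close> steps.
\<close>

lemma sum_frac_coeff:
  assumes "s < 1"
  shows "(\<Sum>n<N. frac_coeff s (Suc n)) = 1 - Gamma (real (Suc N) - s) / (Gamma (1 - s) * fact N)"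
proof (induction N)
  case 0
  have "Gamma (1 - s) \<noteq> 0"
    using assms by (intro less_imp_neq[symmetric] Gamma_real_pos) simp
  then show ?case
    by simp
next
  case (Suc N)
  have Gamma_Suc: "Gamma (real (Suc (Suc N)) - s) = (real (Suc N) - s) * Gamma (real (Suc N) - s)"
  proof -
    have "real (Suc N) - s \<notin> \<int>\<^sub>\<le>\<^sub>0"
      using assms nonpos_Ints_nonpos[of "real (Suc N) - s"] by auto
    then have "Gamma (real (Suc N) - s + 1) = (real (Suc N) - s) * Gamma (real (Suc N) - s)"
      by (rule Gamma_plus1)
    then show ?thesis
      by (simp add: algebra_simps)
  qed
  have fact_Suc: "fact (Suc N) = real (Suc N) * fact N"
    by simp
  define G where "G = Gamma (real (Suc N) - s)"
  have "Gamma (1 - s) \<noteq> 0"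
    using assms by (intro less_imp_neq[symmetric] Gamma_real_pos) simp
  moreover have "frac_coeff s (Suc N) = s * G / (Gamma (1 - s) * (real (Suc N) * fact N))"
    unfolding frac_coeff_def G_def fact_Suc ..
  ultimately show ?case
    unfolding sum.lessThan_Suc Suc.IH Gamma_Suc fact_Suc G_def[symmetric]
    by (simp add: divide_simps del: of_nat_Suc) (simp add: algebra_simps)
qed

text \<open>
  The heart of the convergence: the first coefficient \<open>s\<close> exhausts the mass as \<open>s\<close> tends to \<open>1\<close>, so that
  jumps along two or more steps of the walk disappear.
\<close>

lemma sum_frac_coeff_tail_le:
  assumes "0 < s" "s < 1"
  shows "(\<Sum>n<N. frac_coeff s (Suc (Suc n))) \<le> 1 - s"
proof -
  have "s + (\<Sum>n<N. frac_coeff s (Suc (Suc n))) = (\<Sum>n<Suc N. frac_coeff s (Suc n))"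
    unfolding sum.lessThan_Suc_shift using frac_coeff_1 assms by simp
  also have "\<dots> \<le> 1"
    unfolding sum_frac_coeff[OF \<open>s < 1\<close>] using assms
    by (simp add: less_imp_le[OF Gamma_real_pos])
  finally show ?thesis
    by simp
qed

lemma summable_frac_coeff_tail:
  assumes "0 < s" "s < 1"
  shows "summable (\<lambda>n. frac_coeff s (Suc (Suc n)))"
  by (rule summableI_nonneg_bounded[OF frac_coeff_nonneg[OF assms] sum_frac_coeff_tail_le[OF assms]])

lemma has_bochner_integral_Gamma:
  assumes "0 < (a :: real)"
  shows "has_bochner_integral lborel (\<lambda>t. indicator {0<..} t * (t powr (a - 1) * exp (- t))) (Gamma a)"
proof (rule has_bochner_integral_nn_integral)
  have eq: "indicator {0<..} t * (t powr (a - 1) * exp (- t)) = indicator {0..} t * t powr (a - 1) / exp t"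
    for t :: real
    by (auto simp: indicator_def exp_minus divide_inverse)
  show "(\<integral>\<^sup>+ t. ennreal (indicator {0<..} t * (t powr (a - 1) * exp (- t))) \<partial>lborel) = ennreal (Gamma a)"
    unfolding eq by (rule Gamma_conv_nn_integral_real[OF assms, symmetric])
qed (use Gamma_real_pos[OF assms] in auto)

section \<open>The fractional Laplacian as a subordinated walk\<close>

context weighted_lattice
begin

text \<open>
  The Poisson form of the heat kernel is integrated against \<open>t powr (- 1 - s)\<close> term by term, each term giving a
  Gamma value. Off the diagonal the term with no step vanishes, and it is the only one whose
  integral diverges at \<open>0\<close>.
\<close>

lemma frac_weight_sums:
  assumes "x \<noteq> y" and "0 < s" and "s < 1"
  shows "(\<lambda>n. m x * (frac_coeff s (Suc n) * step_prob (Suc n) x y)) sums frac_weight w s x y"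
proof -
  define C where "C = s / Gamma (1 - s) * m x * m y"
  define a where "a n = step_prob (Suc n) x y / (m y * fact (Suc n))" for n
  define f where "f n t = a n * (indicator {0<..} t * (t powr (real (Suc n) - s - 1) * exp (- t)))"
    for n t
  have a_nonneg: "0 \<le> a n" for n
    using measure_pos[of y] by (simp add: a_def step_prob_nonneg)
  have Gamma_integral: "has_bochner_integral lborel (f n) (a n * Gamma (real (Suc n) - s))" for n
    unfolding f_def using assms
    by (intro has_bochner_integral_mult_right has_bochner_integral_Gamma) auto
  have coeff: "C * (a n * Gamma (real (Suc n) - s)) = m x * (frac_coeff s (Suc n) * step_prob (Suc n) x y)" for n
    using measure_pos[of y] by (simp add: C_def a_def frac_coeff_def)
  have C: "0 < C"
    using assms measure_pos Gamma_real_pos[of "1 - s"] by (simp add: C_def)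
  have f_nonneg: "0 \<le> f n t" for n t
    by (simp add: f_def a_nonneg)
  have f_sums: "(\<lambda>n. f n t) sums (indicator {0<..} t * (heat_kernel w t x y * t powr (- 1 - s)))" for t
  proof (cases "0 < t")
    case True
    have "(\<lambda>n. exp (- t) * (t ^ Suc n / fact (Suc n) * step_prob (Suc n) x y))
        sums heat_semigroup w t (indicator {y}) x"
      using heat_semigroup_indicator_poisson[of t x y] True \<open>x \<noteq> y\<close>
      by (subst sums_Suc_iff) (simp add: step_prob_0)
    then have "(\<lambda>n. exp (- t) * (t ^ Suc n / fact (Suc n) * step_prob (Suc n) x y) * (1 / m y * t powr (- 1 - s)))
        sums (heat_semigroup w t (indicator {y}) x * (1 / m y * t powr (- 1 - s)))"
      by (rule sums_mult2)
    moreover have "exp (- t) * (t ^ Suc n / fact (Suc n) * step_prob (Suc n) x y) * (1 / m y * t powr (- 1 - s)) = f n t" for n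
    proof -
      have "t powr (real (Suc n) - s - 1) = t powr real (Suc n) * t powr (- 1 - s)"
        by (simp add: algebra_simps flip: powr_add)
      also have "\<dots> = t ^ Suc n * t powr (- 1 - s)"
        using True by (simp only: powr_realpow)
      finally have power: "t powr (real (Suc n) - s - 1) = t ^ Suc n * t powr (- 1 - s)" .
      show ?thesis
        using True unfolding f_def a_def power by (simp add: mult_ac)
    qed
    ultimately show ?thesis
      using True by (simp add: heat_kernel_def mult_ac)
  next
    case False
    then show ?thesis by (simp add: f_def)
  qed
  \<comment> \<open>Dominated by the coefficients; this is what justifies exchanging sum and integral.\<close>
  have summable_coeff: "summable (\<lambda>n. m x * (frac_coeff s (Suc n) * step_prob (Suc n) x y))"
  proof (rule summable_mult, rule summable_comparison_test')
    show "summable (\<lambda>n. frac_coeff s (Suc n))"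
      using summable_frac_coeff_tail[OF assms(2,3)] by (rule summable_Suc_iff[THEN iffD1])
    show "norm (frac_coeff s (Suc n) * step_prob (Suc n) x y) \<le> frac_coeff s (Suc n)" for n
      using frac_coeff_nonneg[OF assms(2,3)] by (simp add: abs_mult step_prob_nonneg mult_left_le step_prob_le_1)
  qed
  have "(\<lambda>n. integral\<^sup>L lborel (f n)) sums (\<integral>t. (\<Sum>n. f n t) \<partial>lborel)"
  proof (rule sums_integral)
    show "integrable lborel (f n)" for n
      using Gamma_integral[of n] by (simp add: has_bochner_integral_iff)
    show "AE t in lborel. summable (\<lambda>n. norm (f n t))"
      using sums_summable[OF f_sums] by (simp add: f_nonneg)
    show "summable (\<lambda>n. \<integral>t. norm (f n t) \<partial>lborel)"
      using summable_coeff C unfolding coeff[symmetric]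
      by (simp add: f_nonneg has_bochner_integral_integral_eq[OF Gamma_integral] summable_cmult_iff)
  qed
  also have "(\<integral>t. (\<Sum>n. f n t) \<partial>lborel) = (LBINT t:{0<..}. heat_kernel w t x y * t powr (- 1 - s))"
    unfolding set_lebesgue_integral_def using sums_unique[OF f_sums] by simp
  finally have "(\<lambda>n. C * integral\<^sup>L lborel (f n)) sums frac_weight w s x y"
    unfolding frac_weight_def C_def by (rule sums_mult)
  then show ?thesis
    by (simp only: has_bochner_integral_integral_eq[OF Gamma_integral] coeff)
qed

text \<open>
  The one-step part of the weight contributes exactly \<open>- s \<Delta> u\<close>. What remains is \<open>(1 - s) \<Delta> u\<close> and a jump
  operator with kernel \<open>b \<ge> 0\<close> of total mass at most \<open>1 - s\<close>; each is at most \<open>2 M (1 - s)\<close>, as increments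
  of \<open>u\<close> are at most \<open>2 M\<close>.
\<close>

lemma frac_laplacian_plus_laplacian_le:
  assumes u: "\<And>x. \<bar>u x\<bar> \<le> M" and s: "0 < s" "s < 1"
  shows "\<bar>frac_laplacian w s u x + laplacian w u x\<bar> \<le> 4 * M * (1 - s)"
proof -
  define b where "b y = (\<Sum>n. frac_coeff s (Suc (Suc n)) * step_prob (Suc (Suc n)) x y)" for y
  have term_nonneg: "0 \<le> frac_coeff s (Suc (Suc n)) * step_prob (Suc (Suc n)) x y" for n y
    by (intro mult_nonneg_nonneg frac_coeff_nonneg s step_prob_nonneg)
  have b_summable: "summable (\<lambda>n. frac_coeff s (Suc (Suc n)) * step_prob (Suc (Suc n)) x y)" for y
    by (rule summable_comparison_test'[OF summable_frac_coeff_tail[OF s]])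
      (use frac_coeff_nonneg[OF s] in \<open>simp add: abs_mult step_prob_nonneg mult_left_le step_prob_le_1\<close>)
  have b_nonneg: "0 \<le> b y" for y
    unfolding b_def by (rule suminf_nonneg[OF b_summable term_nonneg])
  have b_mass: "(\<Sum>y\<in>F. b y) \<le> 1 - s" if "finite F" for F
  proof -
    have "(\<Sum>y\<in>F. b y) = (\<Sum>n. \<Sum>y\<in>F. frac_coeff s (Suc (Suc n)) * step_prob (Suc (Suc n)) x y)"
      unfolding b_def by (rule suminf_sum[OF b_summable, symmetric])
    also have "\<dots> \<le> (\<Sum>n. frac_coeff s (Suc (Suc n)))"
    proof (intro suminf_le summable_sum b_summable summable_frac_coeff_tail s)
      fix n
      show "(\<Sum>y\<in>F. frac_coeff s (Suc (Suc n)) * step_prob (Suc (Suc n)) x y) \<le> frac_coeff s (Suc (Suc n))"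
        unfolding sum_distrib_left[symmetric]
        by (intro mult_left_le sum_step_prob_le_1 that frac_coeff_nonneg s)
    qed
    also have "\<dots> \<le> 1 - s"
      by (intro suminf_le_const summable_frac_coeff_tail sum_frac_coeff_tail_le s)
    finally show ?thesis .
  qed
  have frac_weight_split: "frac_weight w s x y = s * w x y + m x * b y" if "y \<noteq> x" for y
  proof -
    have "(\<lambda>n. m x * (frac_coeff s (Suc (Suc n)) * step_prob (Suc (Suc n)) x y))
        sums (frac_weight w s x y - m x * (frac_coeff s (Suc 0) * step_prob (Suc 0) x y))"
      using frac_weight_sums[OF that[symmetric] s] by (subst sums_Suc_iff) simp
    then have "frac_weight w s x y - m x * (frac_coeff s (Suc 0) * step_prob (Suc 0) x y) = m x * b y"
      unfolding b_def using sums_unique2 sums_mult[OF summable_sums[OF b_summable]] by blast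
    then show ?thesis
      using measure_pos[of x] s by (simp add: frac_coeff_1 step_prob_1)
  qed
  let ?D = "\<lambda>y. u x - u y"
  have D: "\<bar>?D y\<bar> \<le> 2 * M" for y
    using u[of x] u[of y] by linarith
  have b_on: "b summable_on A" for A
    by (rule nonneg_bdd_above_summable_on) (use b_nonneg b_mass in \<open>auto intro!: bdd_aboveI\<close>)
  have jump_abs: "(\<lambda>y. norm (b y * ?D y)) summable_on {y. y \<noteq> x}"
  proof (rule summable_on_comparison_test)
    show "(\<lambda>y. b y * (2 * M)) summable_on {y. y \<noteq> x}"
      by (rule summable_on_cmult_left[OF b_on])
    show "norm (b y * ?D y) \<le> b y * (2 * M)" for y
      using mult_left_mono[OF D b_nonneg] b_nonneg by (simp add: abs_mult)
  qed simp
  have "\<bar>\<Sum>\<^sub>\<infinity>y\<in>{y. y \<noteq> x}. b y * ?D y\<bar> \<le> (\<Sum>\<^sub>\<infinity>y\<in>{y. y \<noteq> x}. norm (b y * ?D y))"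
    using norm_infsum_bound[OF jump_abs] by simp
  also have "\<dots> \<le> (\<Sum>\<^sub>\<infinity>y\<in>{y. y \<noteq> x}. b y * (2 * M))"
    using mult_left_mono[OF D b_nonneg] b_nonneg
    by (intro infsum_mono jump_abs summable_on_cmult_left b_on) (simp add: abs_mult)
  also have "\<dots> = (\<Sum>\<^sub>\<infinity>y\<in>{y. y \<noteq> x}. b y) * (2 * M)"
    by (rule infsum_cmult_left[OF b_on])
  also have "\<dots> \<le> (1 - s) * (2 * M)"
    using D[of x] by (intro mult_right_mono infsum_le_finite_sums b_on b_mass) auto
  finally have jump: "\<bar>\<Sum>\<^sub>\<infinity>y\<in>{y. y \<noteq> x}. b y * ?D y\<bar> \<le> (1 - s) * (2 * M)" .
  have irrefl: "\<not> lattice_adj x x"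
    by (simp add: lattice_adj_def)
  have near_on: "(\<lambda>y. w x y * ?D y) summable_on {y. y \<noteq> x}"
  proof (subst summable_on_cong_neutral[where T = "{y. lattice_adj x y}" and g = "\<lambda>y. w x y * ?D y"])
    show "(\<lambda>y. w x y * ?D y) summable_on {y. lattice_adj x y}"
      by (rule summable_on_finite[OF finite_lattice_adj])
  qed (use irrefl weight_eq_0 in auto)
  have near: "(\<Sum>\<^sub>\<infinity>y\<in>{y. y \<noteq> x}. w x y * ?D y) = - (m x * laplacian w u x)"
  proof -
    have "(\<Sum>\<^sub>\<infinity>y\<in>{y. y \<noteq> x}. w x y * ?D y) = (\<Sum>\<^sub>\<infinity>y\<in>{y. lattice_adj x y}. w x y * ?D y)"
      by (rule infsum_cong_neutral) (use irrefl weight_eq_0 in auto)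
    also have "\<dots> = (\<Sum>y | lattice_adj x y. w x y * ?D y)"
      by (rule infsum_finite[OF finite_lattice_adj])
    also have "\<dots> = - (\<Sum>y | lattice_adj x y. w x y * (u y - u x))"
      by (simp add: right_diff_distrib flip: sum_negf)
    finally show ?thesis
      using measure_pos[of x] by (simp add: laplacian_def)
  qed
  have "(\<Sum>\<^sub>\<infinity>y\<in>{y. y \<noteq> x}. frac_weight w s x y * ?D y)
      = (\<Sum>\<^sub>\<infinity>y\<in>{y. y \<noteq> x}. s * (w x y * ?D y) + m x * (b y * ?D y))"
    by (rule infsum_cong) (simp add: frac_weight_split algebra_simps)
  also have "\<dots> = s * (\<Sum>\<^sub>\<infinity>y\<in>{y. y \<noteq> x}. w x y * ?D y) + m x * (\<Sum>\<^sub>\<infinity>y\<in>{y. y \<noteq> x}. b y * ?D y)"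
    using near_on abs_summable_summable[OF jump_abs]
    by (simp add: infsum_add infsum_cmult_right summable_on_cmult_right)
  finally have "frac_laplacian w s u x = - s * laplacian w u x + (\<Sum>\<^sub>\<infinity>y\<in>{y. y \<noteq> x}. b y * ?D y)"
    using measure_pos[of x] unfolding frac_laplacian_def near by (simp add: diff_divide_distrib)
  then have "frac_laplacian w s u x + laplacian w u x
      = (1 - s) * laplacian w u x + (\<Sum>\<^sub>\<infinity>y\<in>{y. y \<noteq> x}. b y * ?D y)"
    by (simp add: algebra_simps)
  moreover have "\<bar>(1 - s) * laplacian w u x\<bar> \<le> (1 - s) * (2 * M)"
  proof -
    have u_bounds: "- M \<le> u y" "u y \<le> M" for y
      using u[of y] by linarith+
    have "- M \<le> walk u x" "walk u x \<le> M"
      using walk_mono[of "\<lambda>_. - M" u x] walk_mono[of u "\<lambda>_. M" x] u_bounds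
      by (simp_all add: walk_const)
    then have "\<bar>laplacian w u x\<bar> \<le> 2 * M"
      using u[of x] by (simp add: laplacian_walk)
    then show ?thesis
      using s by (simp add: abs_mult)
  qed
  ultimately show ?thesis
    using jump by (simp add: algebra_simps)
qed

end

section \<open>Convergence to the Laplacian\<close>

lemma abs_le_linf_norm:
  assumes "linf_norm f < \<infinity>"
  shows "\<bar>f x\<bar> \<le> real_of_ereal (linf_norm f)"
proof -
  have le: "ereal \<bar>f x\<bar> \<le> linf_norm f"
    unfolding linf_norm_def by (rule SUP_upper) simp
  then show ?thesis
    using assms by (cases "linf_norm f") auto
qed

theorem proposition1p6:
  fixes w :: "int ^ 'd \<Rightarrow> int ^ 'd \<Rightarrow> real"
    and u :: "int ^ 'd \<Rightarrow> real"
  assumes "lattice_weights w"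
    and "0 < mu_min w" and "mu_min w \<le> mu_max w" and "mu_max w < \<infinity>"
    and "0 < edge_weight_inf w"
    and "linf_norm u < \<infinity>"
  shows "((\<lambda>s. linf_norm (\<lambda>x. frac_laplacian w s u x + laplacian w u x)) \<longlongrightarrow> 0) (at_left 1)"
proof -
  have "0 < vertex_measure w x" for x
  proof -
    have "mu_min w \<le> ereal (vertex_measure w x)"
      unfolding mu_min_def by (rule INF_lower) simp
    then have "0 < ereal (vertex_measure w x)"
      using assms(2) by (rule less_le_trans[rotated])
    then show ?thesis by simp
  qed
  then interpret weighted_lattice w
    using assms(1) by unfold_locales
  define M where "M = real_of_ereal (linf_norm u)"
  have u: "\<bar>u x\<bar> \<le> M" for x
    unfolding M_def by (rule abs_le_linf_norm[OF assms(6)])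
  have range: "\<forall>\<^sub>F s in at_left (1 :: real). 0 < s \<and> s < 1"
    using eventually_at_left_real[of 0 1] by (auto elim: eventually_mono)
  show ?thesis
  proof (rule tendsto_sandwich[OF _ _ tendsto_const])
    show "\<forall>\<^sub>F s in at_left 1. 0 \<le> linf_norm (\<lambda>x. frac_laplacian w s u x + laplacian w u x)"
      by (auto simp: linf_norm_def intro!: eventuallyI SUP_upper2)
    show "\<forall>\<^sub>F s in at_left 1. linf_norm (\<lambda>x. frac_laplacian w s u x + laplacian w u x)
        \<le> ereal (4 * M * (1 - s))"
      using range
      by eventually_elim (auto simp: linf_norm_def intro!: SUP_least frac_laplacian_plus_laplacian_le u)
    have "((\<lambda>s. 4 * M * (1 - s)) \<longlongrightarrow> 4 * M * (1 - 1)) (at_left 1)"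
      by (intro tendsto_intros)
    then show "((\<lambda>s. ereal (4 * M * (1 - s))) \<longlongrightarrow> 0) (at_left 1)"
      by (simp add: zero_ereal_def)
  qed
qed

end
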